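(* Let $f,h_1,\dots,h_m\in\mathbb{R}[x]=\mathbb{R}[x_1,\dots,x_n]$ and let $V_{\mathbb{R}}(h)=\{x\in\mathbb{R}^n:h_1(x)=\dots=h_m(x)=0\}$ be nonempty. For $\varepsilon\in\mathbb{R}^n$ put $f_{\varepsilon}(x)=f(x)+\varepsilon^Tx$. Suppose that $V_{\mathbb{R}}(h)$ is compact. Then there are positive constants $c,\tau,\nu$ such that $$\mathrm{global}(f_{\varepsilon},V_{\mathbb{R}}(h))\subset\mathrm{global}(f,V_{\mathbb{R}}(h))+c\|\varepsilon\|^{\tau}\,\overline{\mathbb{B}}(0,1)$$ whenever $\|\varepsilon\|\le\nu$.
   Context: $\mathrm{global}(g,V_{\mathbb{R}}(h))$ denotes the set of global minimizers of $g$ over $V_{\mathbb{R}}(h)$. $\overline{\mathbb{B}}(0,1)$ is the closed unit ball of $\mathbb{R}^n$ centered at the origin; the sum of sets is the Minkowski sum. *)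

theory Defs
  imports "HOL-Analysis.Analysis" "HOL-Library.Set_Algebras"
begin

text \<open>
  Real polynomials in \<open>x\<^sub>1, \<dots>, x\<^sub>n\<close> are represented by the functions on \<open>real^'n\<close> they
  induce (\<^const>\<open>real_polynomial_function\<close>). Nothing is lost: the bounded linear functionals on
  \<open>real^'n\<close> are the linear forms in the coordinates, so these functions are exactly the polynomial
  functions, and over the infinite field \<open>\<real>\<close> a polynomial is determined by its values.
\<close>

definition real_variety :: "nat \<Rightarrow> (nat \<Rightarrow> real^'n \<Rightarrow> real) \<Rightarrow> (real^'n) set" where
  "real_variety m h = {x. \<forall>i\<in>{1..m}. h i x = 0}"

definition global_minimizers :: "(real^'n \<Rightarrow> real) \<Rightarrow> (real^'n) set \<Rightarrow> (real^'n) set" where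
  "global_minimizers g S = {x. is_arg_min g (\<lambda>y. y \<in> S) x}"

definition linear_perturbation :: "(real^'n \<Rightarrow> real) \<Rightarrow> real^'n \<Rightarrow> real^'n \<Rightarrow> real" where
  "linear_perturbation f \<epsilon> x = f x + \<epsilon> \<bullet> x"

end

theory Submission
  imports Defs
begin

text \<open>
  A minimizer \<open>x\<close> of \<open>f\<^sub>\<epsilon>\<close> satisfies \<open>f x - min f \<le> D \<parallel>\<epsilon>\<parallel>\<close>, where \<open>D\<close> is the diameter of the
  variety, so everything reduces to a Lojasiewicz inequality
  \<open>dist(x, {F = 0})\<^sup>N \<le> c \<bar>F x\<bar>\<close> on compact sets, applied to
  \<open>F = (f - min f)\<^sup>2 + \<Sum>\<^sub>i h\<^sub>i\<^sup>2\<close>. If the inequality fails for every \<open>N\<close>, a sequence of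
  counterexamples defines a point \<open>x\<close> with hyperreal coordinates such that \<open>e = \<bar>F x\<bar>\<close> is smaller
  than every power of the distance of \<open>x\<close> to the zero set. The hyperreals \<open>a\<close> all of whose powers
  are bounded by \<open>1 / e\<close> form a convex subring \<open>A\<close>, whose maximal ideal contains \<open>e\<close> but not that
  distance. Since the hyperreals are real closed, the residue field of \<open>A\<close> lifts to a subfield of
  \<open>A\<close>, so \<open>x\<close> is congruent to a point \<open>y\<close> with coordinates in a subfield \<open>T \<subseteq> A\<close>. Then \<open>F y\<close>
  lies in \<open>T\<close> and in the maximal ideal, hence \<open>F y = 0\<close>, although \<open>y\<close> is closer to \<open>x\<close> than the
  zero set.
\<close>

section \<open>An ultrapower of the reals\<close>

text \<open>Zorn's lemma yields a maximal family of sets whose finite intersections are all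
  infinite. Asking for infinite rather than nonempty intersections keeps finite sets out of the
  family, and this makes the ultrafilter free.\<close>

lemma free_ultrafilter_exists:
  "\<exists>U :: nat filter. U \<noteq> bot \<and> U \<le> sequentially \<and>
    (\<forall>P. eventually P U \<or> eventually (\<lambda>n. \<not> P n) U)"
proof -
  define \<A> where "\<A> = {E :: nat set set. \<forall>F. finite F \<longrightarrow> F \<subseteq> E \<longrightarrow> infinite (\<Inter>F)}"
  have "\<exists>M\<in>\<A>. \<forall>X\<in>\<A>. M \<subseteq> X \<longrightarrow> X = M"
  proof (rule subset_Zorn_nonempty)
    show "\<A> \<noteq> {}"
      unfolding \<A>_def by (auto intro!: exI[of _ "{}"])
  next
    fix C assume C: "C \<noteq> {}" "subset.chain \<A> C"
    show "\<Union>C \<in> \<A>"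
      unfolding \<A>_def
    proof (intro CollectI allI impI)
      fix F assume F: "finite F" "F \<subseteq> \<Union>C"
      then obtain E where "E \<in> C" "F \<subseteq> E"
        using finite_subset_Union_chain C by metis
      moreover have "E \<in> \<A>"
        using \<open>E \<in> C\<close> C(2) by (auto simp: subset.chain_def)
      ultimately show "infinite (\<Inter>F)"
        using F(1) by (auto simp: \<A>_def)
    qed
  qed
  then obtain M where M: "M \<in> \<A>" and max: "\<And>X. X \<in> \<A> \<Longrightarrow> M \<subseteq> X \<Longrightarrow> X = M"
    by blast
  have fip: "infinite (\<Inter>F)" if "finite F" "F \<subseteq> M" for F
    using M that by (auto simp: \<A>_def)
  \<comment> \<open>By maximality, adding \<open>P\<close> must produce a finite intersection. If
    neither \<open>P\<close> nor its complement belonged to \<open>M\<close>, two such finite pieces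
    would cover an infinite intersection of members of \<open>M\<close>.\<close>
  have small: "\<exists>F. finite F \<and> F \<subseteq> M \<and> finite (P \<inter> \<Inter>F)" if P: "P \<notin> M" for P
  proof -
    have "insert P M \<notin> \<A>"
      using max[of "insert P M"] P by auto
    then obtain G where G: "finite G" "G \<subseteq> insert P M" "finite (\<Inter>G)"
      by (auto simp: \<A>_def)
    have "P \<inter> \<Inter>(G - {P}) \<subseteq> \<Inter>G"
      by auto
    then have "finite (P \<inter> \<Inter>(G - {P}))"
      using G(3) finite_subset by blast
    then show ?thesis
      using G by (intro exI[of _ "G - {P}"]) auto
  qed
  have ultra: "P \<in> M \<or> - P \<in> M" for P
  proof (rule ccontr)
    assume "\<not> (P \<in> M \<or> - P \<in> M)"
    then obtain F G where "finite F" "F \<subseteq> M" "finite (P \<inter> \<Inter>F)"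
        and "finite G" "G \<subseteq> M" "finite (- P \<inter> \<Inter>G)"
      using small by meson
    then have "finite ((P \<inter> \<Inter>F) \<union> (- P \<inter> \<Inter>G))" "infinite (\<Inter>(F \<union> G))"
      using fip[of "F \<union> G"] by auto
    moreover have "\<Inter>(F \<union> G) \<subseteq> (P \<inter> \<Inter>F) \<union> (- P \<inter> \<Inter>G)"
      by auto
    ultimately show False
      using finite_subset by blast
  qed
  define U where "U = (INF P\<in>M. principal P)"
  have ev: "eventually (\<lambda>n. n \<in> P) U" if "P \<in> M" for P
  proof -
    have "U \<le> principal P"
      unfolding U_def using that by (rule INF_lower)
    then show ?thesis
      by (simp add: le_principal)
  qed
  have "U \<noteq> bot"
    unfolding U_def
  proof (rule INF_filter_not_bot)
    fix F assume F: "F \<subseteq> M" "finite F"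
    then have "\<Inter>F \<noteq> {}"
      using fip[of F] by auto
    then show "(INF P\<in>F. principal P) \<noteq> bot"
      using F(2) by (simp add: INF_principal_finite principal_eq_bot_iff)
  qed
  moreover have "U \<le> sequentially"
    unfolding at_top_def
  proof (rule INF_greatest)
    fix k :: nat
    have "{..<k} \<notin> M"
      using fip[of "{{..<k}}"] by auto
    then have "- {..<k} \<in> M"
      using ultra by blast
    from ev[OF this] show "U \<le> principal {k..}"
      by (simp add: le_principal not_less)
  qed
  moreover have "eventually P U \<or> eventually (\<lambda>n. \<not> P n) U" for P
    using ultra[of "Collect P"] ev[of "Collect P"] ev[of "- Collect P"] by auto
  ultimately show ?thesis
    by blast
qed

definition ultra :: "nat filter" where
  "ultra = (SOME U. U \<noteq> bot \<and> U \<le> sequentially \<and>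
    (\<forall>P. eventually P U \<or> eventually (\<lambda>n. \<not> P n) U))"

lemma ultra_not_bot [simp]: "ultra \<noteq> bot"
  and ultra_le_sequentially: "ultra \<le> sequentially"
  and ultra_dichotomy: "eventually P ultra \<or> eventually (\<lambda>n. \<not> P n) ultra"
  using someI_ex[OF free_ultrafilter_exists] unfolding ultra_def[symmetric] by auto

text \<open>The dichotomy makes \<open>eventually\<close> commute with negation, hence with all
  propositional connectives. This is the quantifier-free case of Los's theorem, by which the ordered
  field axioms can be checked index by index.\<close>

lemma eventually_ultra_not: "\<not> eventually P ultra \<longleftrightarrow> eventually (\<lambda>n. \<not> P n) ultra"
  using ultra_dichotomy[of P] eventually_conj[of P ultra "\<lambda>n. \<not> P n"] by auto

lemma eventually_ultra_conj:
  "eventually P ultra \<and> eventually Q ultra \<longleftrightarrow> eventually (\<lambda>n. P n \<and> Q n) ultra"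
  by (simp add: eventually_conj_iff)

lemma eventually_ultra_imp:
  "(eventually P ultra \<longrightarrow> eventually Q ultra) \<longleftrightarrow> eventually (\<lambda>n. P n \<longrightarrow> Q n) ultra"
proof (cases "eventually P ultra")
  case True
  then have "eventually Q ultra = eventually (\<lambda>n. P n \<longrightarrow> Q n) ultra"
    by (intro eventually_subst) (elim eventually_mono, simp)
  with True show ?thesis
    by simp
next
  case False
  then have "eventually (\<lambda>n. \<not> P n) ultra"
    by (simp add: eventually_ultra_not)
  then have "eventually (\<lambda>n. P n \<longrightarrow> Q n) ultra"
    by (rule eventually_mono) simp
  with False show ?thesis
    by simp
qed

lemma eventually_ultra_disj:
  "eventually P ultra \<or> eventually Q ultra \<longleftrightarrow> eventually (\<lambda>n. P n \<or> Q n) ultra"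
  using eventually_ultra_imp[of "\<lambda>n. \<not> P n" Q] by (simp only: disj_imp eventually_ultra_not)

lemma eventually_ultra_iff:
  "(eventually P ultra \<longleftrightarrow> eventually Q ultra) \<longleftrightarrow> eventually (\<lambda>n. P n \<longleftrightarrow> Q n) ultra"
  unfolding iff_conv_conj_imp eventually_ultra_imp eventually_ultra_conj by simp

lemmas eventually_ultra = eventually_ultra_not eventually_ultra_conj eventually_ultra_imp
  eventually_ultra_disj eventually_ultra_iff

\<comment> \<open>The ordered field of hyperreals\<close>
quotient_type hyperreal = "nat \<Rightarrow> real" / "\<lambda>x y. eventually (\<lambda>n. x n = y n) ultra"
  morphisms rep_hyperreal hyper
proof (rule equivpI)
  show "reflp (\<lambda>x y :: nat \<Rightarrow> real. eventually (\<lambda>n. x n = y n) ultra)"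
    by (auto intro: reflpI)
  show "symp (\<lambda>x y :: nat \<Rightarrow> real. eventually (\<lambda>n. x n = y n) ultra)"
    by (intro sympI) (erule eventually_mono, simp)
  show "transp (\<lambda>x y :: nat \<Rightarrow> real. eventually (\<lambda>n. x n = y n) ultra)"
    by (intro transpI) (erule (1) eventually_elim2, simp)
qed

instantiation hyperreal :: "{zero, one, plus, minus, times, uminus, inverse, abs, sgn, ord}"
begin

lift_definition zero_hyperreal :: hyperreal is "\<lambda>n. 0" .
lift_definition one_hyperreal :: hyperreal is "\<lambda>n. 1" .
lift_definition plus_hyperreal :: "hyperreal \<Rightarrow> hyperreal \<Rightarrow> hyperreal" is "\<lambda>x y n. x n + y n"
  by (erule (1) eventually_elim2) simp
lift_definition minus_hyperreal :: "hyperreal \<Rightarrow> hyperreal \<Rightarrow> hyperreal" is "\<lambda>x y n. x n - y n"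
  by (erule (1) eventually_elim2) simp
lift_definition times_hyperreal :: "hyperreal \<Rightarrow> hyperreal \<Rightarrow> hyperreal" is "\<lambda>x y n. x n * y n"
  by (erule (1) eventually_elim2) simp
lift_definition divide_hyperreal :: "hyperreal \<Rightarrow> hyperreal \<Rightarrow> hyperreal" is "\<lambda>x y n. x n / y n"
  by (erule (1) eventually_elim2) simp
lift_definition uminus_hyperreal :: "hyperreal \<Rightarrow> hyperreal" is "\<lambda>x n. - x n"
  by (erule eventually_mono) simp
lift_definition inverse_hyperreal :: "hyperreal \<Rightarrow> hyperreal" is "\<lambda>x n. inverse (x n)"
  by (erule eventually_mono) simp
lift_definition abs_hyperreal :: "hyperreal \<Rightarrow> hyperreal" is "\<lambda>x n. \<bar>x n\<bar>"
  by (erule eventually_mono) simp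
lift_definition sgn_hyperreal :: "hyperreal \<Rightarrow> hyperreal" is "\<lambda>x n. sgn (x n)"
  by (erule eventually_mono) simp
lift_definition less_eq_hyperreal :: "hyperreal \<Rightarrow> hyperreal \<Rightarrow> bool"
  is "\<lambda>x y. eventually (\<lambda>n. x n \<le> y n) ultra"
  by (rule eventually_subst, erule (1) eventually_elim2) simp
lift_definition less_hyperreal :: "hyperreal \<Rightarrow> hyperreal \<Rightarrow> bool"
  is "\<lambda>x y. eventually (\<lambda>n. x n < y n) ultra"
  by (rule eventually_subst, erule (1) eventually_elim2) simp

instance ..

end

instance hyperreal :: linordered_field
proof
  fix a b c :: hyperreal
  show "a + b + c = a + (b + c)" "a + b = b + a" "0 + a = a" "- a + a = 0" "a - b = a + - b"
    "a * b * c = a * (b * c)" "a * b = b * a" "1 * a = a" "(a + b) * c = a * c + b * c"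
    "a + b - a = b" "a - b - c = a - (b + c)" "0 * a = 0" "a * 0 = 0"
    by (transfer; simp add: algebra_simps)+
  show "(0::hyperreal) \<noteq> 1"
    by transfer simp
  show "a / b = a * inverse b"
    by transfer (simp add: divide_inverse)
  \<comment> \<open>Axioms with premises are stated as one object-level formula, so that after
    \<open>transfer\<close> the rules \<open>eventually_ultra\<close> can gather the whole formula
    under a single \<open>eventually\<close>.\<close>
  have "a \<noteq> 0 \<longrightarrow> inverse a * a = 1"
    by transfer (simp add: eventually_ultra)
  then show "a \<noteq> 0 \<Longrightarrow> inverse a * a = 1" ..
  show "inverse (0::hyperreal) = 0"
    by transfer simp
  show "(a < b) = (a \<le> b \<and> \<not> b \<le> a)"
    by transfer (simp only: eventually_ultra, intro always_eventually allI, auto)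
  show "a \<le> a"
    by transfer simp
  have "a \<le> b \<and> b \<le> c \<longrightarrow> a \<le> c"
    by transfer (simp only: eventually_ultra, intro always_eventually allI, auto)
  then show "a \<le> b \<Longrightarrow> b \<le> c \<Longrightarrow> a \<le> c"
    by blast
  have "a \<le> b \<and> b \<le> a \<longrightarrow> a = b"
    by transfer (simp only: eventually_ultra, intro always_eventually allI, auto)
  then show "a \<le> b \<Longrightarrow> b \<le> a \<Longrightarrow> a = b"
    by blast
  show "a \<le> b \<or> b \<le> a"
    by transfer (simp only: eventually_ultra, intro always_eventually allI, auto)
  show "a \<le> b \<Longrightarrow> c + a \<le> c + b"
    by transfer simp
  have "a < b \<and> 0 < c \<longrightarrow> c * a < c * b"
    by transfer (simp only: eventually_ultra, intro always_eventually allI, auto)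
  then show "a < b \<Longrightarrow> 0 < c \<Longrightarrow> c * a < c * b"
    by blast
  have "(a < 0 \<longrightarrow> \<bar>a\<bar> = - a) \<and> (\<not> a < 0 \<longrightarrow> \<bar>a\<bar> = a)"
    by transfer (simp only: eventually_ultra, intro always_eventually allI, auto)
  then show "\<bar>a\<bar> = (if a < 0 then - a else a)"
    by simp
  have "(a = 0 \<longrightarrow> sgn a = 0) \<and> (a \<noteq> 0 \<and> 0 < a \<longrightarrow> sgn a = 1) \<and>
      (a \<noteq> 0 \<and> \<not> 0 < a \<longrightarrow> sgn a = - 1)"
    by transfer (simp only: eventually_ultra, intro always_eventually allI, auto)
  then show "sgn a = (if a = 0 then 0 else if 0 < a then 1 else - 1)"
    by simp
qed

lemma hyper_eq_iff: "hyper x = hyper y \<longleftrightarrow> eventually (\<lambda>n. x n = y n) ultra"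
  and hyper_le_iff: "hyper x \<le> hyper y \<longleftrightarrow> eventually (\<lambda>n. x n \<le> y n) ultra"
  and hyper_less_iff: "hyper x < hyper y \<longleftrightarrow> eventually (\<lambda>n. x n < y n) ultra"
  by (transfer; simp)+

lemma hyper_0: "hyper (\<lambda>n. 0) = 0"
  and hyper_1: "hyper (\<lambda>n. 1) = 1"
  and hyper_add: "hyper (\<lambda>n. x n + y n) = hyper x + hyper y"
  and hyper_diff: "hyper (\<lambda>n. x n - y n) = hyper x - hyper y"
  and hyper_mult: "hyper (\<lambda>n. x n * y n) = hyper x * hyper y"
  and hyper_abs: "hyper (\<lambda>n. \<bar>x n\<bar>) = \<bar>hyper x\<bar>"
  and hyper_inverse: "hyper (\<lambda>n. inverse (x n)) = inverse (hyper x)"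
  and hyper_minus: "hyper (\<lambda>n. - x n) = - hyper x"
  by (transfer; simp)+

lemma hyper_power: "hyper (\<lambda>n. x n ^ k) = hyper x ^ k"
  by (induction k) (simp_all add: hyper_1 hyper_mult)

lemma hyper_sum: "hyper (\<lambda>n. \<Sum>i\<in>I. x i n) = (\<Sum>i\<in>I. hyper (x i))"
  by (induction I rule: infinite_finite_induct) (simp_all add: hyper_0 hyper_add)

lemma hyper_cases: obtains x where "a = hyper x"
  using Quotient3_abs_rep[OF Quotient3_hyperreal, of a] by metis

text \<open>Representing each coefficient by a sequence of reals turns a hyperreal polynomial into a
  sequence of real polynomials, to which real analysis applies at every index.\<close>

lemma hyperreal_poly_cases:
  obtains P where "\<And>x. poly p (hyper x) = hyper (\<lambda>n. poly (P n) (x n))"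
proof -
  have "\<exists>P. \<forall>x. poly p (hyper x) = hyper (\<lambda>n. poly (P n) (x n))"
  proof (induction p)
    case 0
    show ?case
      by (intro exI[of _ "\<lambda>n. 0"]) (simp add: hyper_0)
  next
    case (pCons a p)
    then obtain P where P: "\<And>x. poly p (hyper x) = hyper (\<lambda>n. poly (P n) (x n))"
      by blast
    obtain c where "a = hyper c"
      by (rule hyper_cases)
    then show ?case
      by (intro exI[of _ "\<lambda>n. pCons (c n) (P n)"]) (simp add: P hyper_add hyper_mult)
  qed
  then show ?thesis
    using that by blast
qed

lemma hyperreal_poly_IVT:
  fixes p :: "hyperreal poly"
  assumes "a < b" "poly p a * poly p b < 0"
  shows "\<exists>x. a \<le> x \<and> x \<le> b \<and> poly p x = 0"
proof -
  obtain u v where uv: "a = hyper u" "b = hyper v"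
    by (meson hyper_cases)
  obtain P where P: "\<And>x. poly p (hyper x) = hyper (\<lambda>n. poly (P n) (x n))"
    using hyperreal_poly_cases by blast
  \<comment> \<open>A real root is chosen at each index. Where the sign change fails,
    \<open>SOME\<close> returns an arbitrary value, which is harmless because such indices are
    negligible for the ultrafilter.\<close>
  define w where "w n = (SOME x. u n \<le> x \<and> x \<le> v n \<and> poly (P n) x = 0)" for n
  have "eventually (\<lambda>n. u n < v n) ultra"
    "eventually (\<lambda>n. poly (P n) (u n) * poly (P n) (v n) < 0) ultra"
    using assms by (simp_all add: uv P hyper_mult[symmetric] hyper_0[symmetric] hyper_less_iff)
  then have *: "eventually (\<lambda>n. u n \<le> w n \<and> w n \<le> v n \<and> poly (P n) (w n) = 0) ultra"
  proof eventually_elim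
    case (elim n)
    then have "\<exists>x. u n \<le> x \<and> x \<le> v n \<and> poly (P n) x = 0"
      using poly_IVT[of "u n" "v n" "P n"] by (meson less_imp_le)
    then show ?case
      unfolding w_def by (rule someI_ex)
  qed
  then have "a \<le> hyper w" "hyper w \<le> b" "poly p (hyper w) = 0"
    by (auto simp: uv P hyper_0[symmetric] hyper_le_iff hyper_eq_iff eventually_conj_iff)
  then show ?thesis
    by blast
qed

section \<open>Convex subrings of real closed fields\<close>

text \<open>As \<open>inverse 0 = 0\<close>, closure under \<open>inverse\<close> can be required of
  all elements at once.\<close>

definition subfield :: "'a::field set \<Rightarrow> bool" where
  "subfield S \<longleftrightarrow> 0 \<in> S \<and> 1 \<in> S \<and> (\<forall>x\<in>S. \<forall>y\<in>S. x + y \<in> S \<and> x * y \<in> S) \<and>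
    (\<forall>x\<in>S. - x \<in> S \<and> inverse x \<in> S)"

lemma subfieldD:
  assumes "subfield S"
  shows "0 \<in> S" "1 \<in> S" "x \<in> S \<Longrightarrow> y \<in> S \<Longrightarrow> x + y \<in> S" "x \<in> S \<Longrightarrow> y \<in> S \<Longrightarrow> x * y \<in> S"
    "x \<in> S \<Longrightarrow> - x \<in> S" "x \<in> S \<Longrightarrow> inverse x \<in> S" "x \<in> S \<Longrightarrow> y \<in> S \<Longrightarrow> x - y \<in> S"
    "x \<in> S \<Longrightarrow> y \<in> S \<Longrightarrow> x / y \<in> S"
proof -
  show "0 \<in> S" "1 \<in> S" "x \<in> S \<Longrightarrow> y \<in> S \<Longrightarrow> x + y \<in> S" "x \<in> S \<Longrightarrow> y \<in> S \<Longrightarrow> x * y \<in> S"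
    "x \<in> S \<Longrightarrow> - x \<in> S" "x \<in> S \<Longrightarrow> inverse x \<in> S"
    using assms by (auto simp: subfield_def)
  then show "x \<in> S \<Longrightarrow> y \<in> S \<Longrightarrow> x - y \<in> S" "x \<in> S \<Longrightarrow> y \<in> S \<Longrightarrow> x / y \<in> S"
    using assms unfolding diff_conv_add_uminus divide_inverse subfield_def by blast+
qed

lemma subfield_sum: "subfield S \<Longrightarrow> (\<And>i. i \<in> I \<Longrightarrow> f i \<in> S) \<Longrightarrow> sum f I \<in> S"
  by (induction I rule: infinite_finite_induct) (auto intro: subfieldD)

lemma subfield_of_nat: "subfield S \<Longrightarrow> of_nat n \<in> S"
  by (induction n) (auto intro: subfieldD)

definition polys_over :: "'a::comm_ring_1 set \<Rightarrow> 'a poly set" where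
  "polys_over S = {p. \<forall>i. coeff p i \<in> S}"

lemma polys_over_subfield:
  assumes "subfield S"
  shows "c \<in> S \<Longrightarrow> [:c:] \<in> polys_over S" "c \<in> S \<Longrightarrow> monom c n \<in> polys_over S"
    "p \<in> polys_over S \<Longrightarrow> q \<in> polys_over S \<Longrightarrow> p + q \<in> polys_over S"
    "p \<in> polys_over S \<Longrightarrow> q \<in> polys_over S \<Longrightarrow> p - q \<in> polys_over S"
    "p \<in> polys_over S \<Longrightarrow> q \<in> polys_over S \<Longrightarrow> p * q \<in> polys_over S"
    "p \<in> polys_over S \<Longrightarrow> - p \<in> polys_over S"
    "p \<in> polys_over S \<Longrightarrow> pderiv p \<in> polys_over S"
  using subfieldD[OF assms] subfield_of_nat[OF assms, of "Suc _"]
  by (auto simp: polys_over_def coeff_pCons coeff_mult coeff_pderiv split: nat.splits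
      intro!: subfield_sum[OF assms] simp del: of_nat_Suc)

section \<open>Convex subrings and their maximal ideals\<close>

locale convex_subring =
  fixes A :: "'a::linordered_field set"
  assumes one: "1 \<in> A"
    and add: "x \<in> A \<Longrightarrow> y \<in> A \<Longrightarrow> x + y \<in> A"
    and mult: "x \<in> A \<Longrightarrow> y \<in> A \<Longrightarrow> x * y \<in> A"
    and convex: "y \<in> A \<Longrightarrow> \<bar>x\<bar> \<le> \<bar>y\<bar> \<Longrightarrow> x \<in> A"
begin

text \<open>The non-units of \<open>A\<close>, in a form that makes the ideal laws immediate.\<close>

definition maximal_ideal :: "'a set" where
  "maximal_ideal = {x. \<forall>a\<in>A. \<bar>a * x\<bar> < 1}"

lemma zero: "0 \<in> A"
  using convex[OF one, of 0] by simp

lemma uminus: "x \<in> A \<Longrightarrow> - x \<in> A"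
  using convex[of x "- x"] by simp

lemma diff: "x \<in> A \<Longrightarrow> y \<in> A \<Longrightarrow> x - y \<in> A"
  using add[of x "- y"] uminus by simp

lemma sum: "(\<And>i. i \<in> I \<Longrightarrow> f i \<in> A) \<Longrightarrow> sum f I \<in> A"
  by (induction I rule: infinite_finite_induct) (auto intro: zero add)

lemma ideal_lt_1: "x \<in> maximal_ideal \<Longrightarrow> \<bar>x\<bar> < 1"
  using one by (force simp: maximal_ideal_def)

lemma ideal_subset: "x \<in> maximal_ideal \<Longrightarrow> x \<in> A"
  using ideal_lt_1[of x] convex[OF one, of x] by simp

lemma ideal_zero: "0 \<in> maximal_ideal"
  by (simp add: maximal_ideal_def)

lemma ideal_convex: "y \<in> maximal_ideal \<Longrightarrow> \<bar>x\<bar> \<le> \<bar>y\<bar> \<Longrightarrow> x \<in> maximal_ideal"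
  unfolding maximal_ideal_def abs_mult
  by (auto intro: le_less_trans[OF mult_left_mono])

lemma ideal_mult: "x \<in> A \<Longrightarrow> y \<in> maximal_ideal \<Longrightarrow> x * y \<in> maximal_ideal"
  unfolding maximal_ideal_def using mult by (auto simp: mult.assoc[symmetric])

lemma ideal_add:
  assumes "x \<in> maximal_ideal" "y \<in> maximal_ideal"
  shows "x + y \<in> maximal_ideal"
  unfolding maximal_ideal_def
proof (intro CollectI ballI)
  fix a assume "a \<in> A"
  \<comment> \<open>Testing with the doubled multiplier bounds each of the two summands by one
    half.\<close>
  then have "a + a \<in> A"
    using add by blast
  then have "\<bar>(a + a) * x\<bar> < 1" "\<bar>(a + a) * y\<bar> < 1"
    using assms by (auto simp: maximal_ideal_def)
  then have "2 * \<bar>a * x\<bar> < 1" "2 * \<bar>a * y\<bar> < 1"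
    by (simp_all add: mult_2[symmetric] abs_mult)
  moreover have "\<bar>a * (x + y)\<bar> \<le> \<bar>a * x\<bar> + \<bar>a * y\<bar>"
    by (simp add: distrib_left)
  ultimately show "\<bar>a * (x + y)\<bar> < 1"
    by linarith
qed

lemma ideal_uminus: "x \<in> maximal_ideal \<Longrightarrow> - x \<in> maximal_ideal"
  using ideal_convex[of x "- x"] by simp

lemma ideal_sum: "(\<And>i. i \<in> I \<Longrightarrow> f i \<in> maximal_ideal) \<Longrightarrow> sum f I \<in> maximal_ideal"
  by (induction I rule: infinite_finite_induct) (auto intro: ideal_zero ideal_add)

text \<open>A witness \<open>a\<close> with \<open>1 \<le> \<bar>a * x\<bar>\<close> bounds
  \<open>\<bar>inverse x\<bar>\<close> by \<open>\<bar>a\<bar>\<close>, and convexity does the rest.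
  Hence every element of \<open>A\<close> outside the ideal is a unit of \<open>A\<close>.\<close>

lemma inverse_mem:
  assumes "x \<notin> maximal_ideal"
  shows "inverse x \<in> A"
proof -
  obtain a where a: "a \<in> A" "1 \<le> \<bar>a * x\<bar>"
    using assms by (auto simp: maximal_ideal_def not_less)
  then have "x \<noteq> 0"
    by auto
  with a have "\<bar>inverse x\<bar> \<le> \<bar>a\<bar>"
    by (simp add: abs_mult field_simps)
  with a(1) show ?thesis
    by (rule convex)
qed

text \<open>The inverse of a nonzero \<open>x\<close> would be an admissible multiplier in
  \<open>A\<close> and give \<open>1 < 1\<close>. This is what turns smallness into exact vanishing
  in the Lojasiewicz argument.\<close>

lemma subfield_ideal_eq_0:
  assumes "subfield S" "S \<subseteq> A" "x \<in> S" "x \<in> maximal_ideal"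
  shows "x = 0"
proof (rule ccontr)
  assume "x \<noteq> 0"
  have "inverse x \<in> A"
    using assms subfieldD(6) by blast
  then have "\<bar>inverse x * x\<bar> < 1"
    using assms(4) by (auto simp: maximal_ideal_def)
  with \<open>x \<noteq> 0\<close> show False
    by simp
qed

lemma poly_mem:
  assumes "p \<in> polys_over A" "x \<in> A"
  shows "poly p x \<in> A"
  using assms(1)
proof (induction p)
  case (pCons c p)
  then have "c \<in> A" "p \<in> polys_over A"
    by (auto simp: polys_over_def coeff_pCons split: nat.splits)
  then show ?case
    using pCons.IH assms(2) by (auto intro!: add mult)
qed (simp add: zero)

lemma poly_diff_mem_ideal:
  assumes "p \<in> polys_over A" "x \<in> A" "y - x \<in> maximal_ideal"
  shows "poly p y - poly p x \<in> maximal_ideal"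
  using assms(1)
proof (induction p)
  case (pCons c p)
  then have p: "p \<in> polys_over A"
    by (auto simp: polys_over_def coeff_pCons split: nat.splits)
  have y: "y \<in> A"
    using add[OF assms(2) ideal_subset[OF assms(3)]] by simp
  have "poly (pCons c p) y - poly (pCons c p) x = y * (poly p y - poly p x) + poly p x * (y - x)"
    by (simp add: algebra_simps)
  then show ?case
    using pCons.IH p y poly_mem[OF p assms(2)] assms(3) ideal_mult ideal_add by auto
qed (simp add: ideal_zero)

lemma poly_taylor:
  assumes "p \<in> polys_over A" "x \<in> A" "d \<in> A"
  shows "\<exists>r\<in>A. poly p (x + d) = poly p x + poly (pderiv p) x * d + r * d ^ 2"
  using assms(1)
proof (induction p)
  case (pCons c p)
  then have p: "p \<in> polys_over A"
    by (auto simp: polys_over_def coeff_pCons split: nat.splits)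
  then obtain r where r: "r \<in> A" "poly p (x + d) = poly p x + poly (pderiv p) x * d + r * d ^ 2"
    using pCons.IH by blast
  have "pderiv p \<in> polys_over A"
  proof -
    have "of_nat n \<in> A" for n
      by (induction n) (auto intro: zero one add)
    from this[of "Suc _"] show ?thesis
      using p mult by (auto simp: polys_over_def coeff_pderiv simp del: of_nat_Suc)
  qed
  \<comment> \<open>Multiplying the expansion of \<open>p\<close> by \<open>x + d\<close> sends its
    linear term partly into second order; this is the new coefficient of
    \<open>d ^ 2\<close>.\<close>
  then have "poly (pderiv p) x + r * (x + d) \<in> A"
    using r(1) assms(2,3) by (auto intro!: add mult poly_mem)
  moreover have "poly (pCons c p) (x + d) = poly (pCons c p) x + poly (pderiv (pCons c p)) x * d
      + (poly (pderiv p) x + r * (x + d)) * d ^ 2"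
    unfolding poly_pCons r(2) pderiv_pCons by (simp add: algebra_simps power2_eq_square)
  ultimately show ?case
    by blast
qed (auto intro: zero)

end

section \<open>Hensel's lemma and lifting the residue field\<close>

locale convex_subring_IVT = convex_subring A for A :: "'a::linordered_field set" +
  assumes poly_IVT: "(a::'a) < b \<Longrightarrow> poly p a * poly p b < 0 \<Longrightarrow> \<exists>x. a \<le> x \<and> x \<le> b \<and> poly p x = 0"
begin

text \<open>Completeness is replaced by a sign change. Twice the Newton step carries
  \<open>poly p a\<close> to nearly its negative, so the intermediate value property gives a root
  between \<open>a\<close> and \<open>a + d\<close>. Since \<open>d\<close> is in the ideal,
  convexity puts the root in the residue class of \<open>a\<close>.\<close>

lemma hensel:
  assumes p: "p \<in> polys_over A" and a: "a \<in> A"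
    and pa: "poly p a \<in> maximal_ideal" and p'a: "poly (pderiv p) a \<notin> maximal_ideal"
  shows "\<exists>b. b - a \<in> maximal_ideal \<and> poly p b = 0"
proof (cases "poly p a = 0")
  case True
  then show ?thesis
    by (intro exI[of _ a]) (simp add: ideal_zero)
next
  case False
  define s where "s = poly (pderiv p) a"
  define u where "u = inverse s * poly p a"
  have s: "inverse s \<in> A" "s \<noteq> 0"
    using inverse_mem p'a ideal_zero unfolding s_def by auto
  have u: "u \<in> maximal_ideal"
    unfolding u_def using s pa ideal_mult by blast
  define d where "d = - (u + u)"
  have d: "d \<in> maximal_ideal"
    unfolding d_def using u ideal_add ideal_uminus by blast
  obtain r where r: "r \<in> A" "poly p (a + d) = poly p a + s * d + r * d ^ 2"
    using poly_taylor[OF p a ideal_subset[OF d]] unfolding s_def by blast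
  \<comment> \<open>The quadratic Taylor remainder relative to \<open>poly p a\<close>: because
    \<open>d = - 2 * u\<close>, it satisfies \<open>r * d ^ 2 = poly p a * e\<close>.\<close>
  define e where "e = (- (r * inverse s) - r * inverse s) * d"
  have "e \<in> maximal_ideal"
    unfolding e_def using r(1) s(1) d by (intro ideal_mult diff uminus mult)
  then have e: "\<bar>e\<bar> < 1"
    by (rule ideal_lt_1)
  have pu: "poly p a = s * u"
    using s(2) by (simp add: u_def)
  have "poly p (a + d) = poly p a * (e - 1)"
    unfolding r(2) pu using s(2) by (simp add: e_def d_def field_simps power2_eq_square)
  then have "poly p a * poly p (a + d) = (poly p a)\<^sup>2 * (e - 1)"
    by (simp add: power2_eq_square)
  also have "\<dots> < 0"
    using False e by (intro mult_pos_neg) auto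
  finally have neg: "poly p a * poly p (a + d) < 0" .
  then have "a \<noteq> a + d"
    by (metis not_less zero_le_square)
  then consider "a < a + d" | "a + d < a"
    by linarith
  then have "\<exists>x. \<bar>x - a\<bar> \<le> \<bar>d\<bar> \<and> poly p x = 0"
  proof cases
    case 1
    with poly_IVT[of a "a + d"] neg obtain x where "a \<le> x" "x \<le> a + d" "poly p x = 0"
      by blast
    then show ?thesis
      by (intro exI[of _ x]) auto
  next
    case 2
    with poly_IVT[of "a + d" a] neg obtain x where "a + d \<le> x" "x \<le> a" "poly p x = 0"
      by (auto simp: mult.commute)
    then show ?thesis
      by (intro exI[of _ x]) auto
  qed
  then show ?thesis
    using d ideal_convex by blast
qed

text \<open>
  If the residue of \<open>a\<close> is transcendental over \<open>S\<close>, then \<open>b = a\<close> will do. Otherwise \<open>b\<close> is the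
  Hensel lift of \<open>a\<close> to a root of a polynomial over \<open>S\<close> of least degree vanishing at that residue.
\<close>

lemma congruent_element_poly_values:
  assumes S: "subfield S" "S \<subseteq> A" and a: "a \<in> A"
  shows "\<exists>b. b - a \<in> maximal_ideal \<and>
    (\<forall>r\<in>polys_over S. poly r b \<in> maximal_ideal \<longrightarrow> poly r b = 0)"
proof (cases "\<exists>p\<in>polys_over S. p \<noteq> 0 \<and> poly p a \<in> maximal_ideal")
  case False
  then show ?thesis
    by (intro exI[of _ a]) (auto simp: ideal_zero)
next
  case True
  then obtain p where p: "p \<in> polys_over S" "p \<noteq> 0" "poly p a \<in> maximal_ideal"
      and min: "\<And>q. q \<in> polys_over S \<Longrightarrow> q \<noteq> 0 \<Longrightarrow> poly q a \<in> maximal_ideal \<Longrightarrow> degree p \<le> degree q"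
    using ex_has_least_nat[of "\<lambda>p. p \<in> polys_over S \<and> p \<noteq> 0 \<and> poly p a \<in> maximal_ideal" _ degree]
    by blast
  have over_A: "q \<in> polys_over A" if "q \<in> polys_over S" for q
    using that S(2) by (auto simp: polys_over_def)
  have deg: "degree p \<noteq> 0"
  proof
    assume "degree p = 0"
    then obtain c where c: "p = [:c:]"
      using degree_eq_zeroE by blast
    then have "c \<in> S" "c \<in> maximal_ideal"
      using p by (auto simp: polys_over_def dest: spec[of _ 0])
    then have "c = 0"
      using subfield_ideal_eq_0[OF S] by blast
    then show False
      using p(2) c by simp
  qed
  \<comment> \<open>In characteristic zero the derivative of the nonconstant \<open>p\<close> is
    nonzero of smaller degree, so minimality of \<open>p\<close> excludes it.\<close>
  have "poly (pderiv p) a \<notin> maximal_ideal"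
    using min[OF polys_over_subfield(7)[OF S(1) p(1)]] deg
    by (auto simp: degree_pderiv pderiv_eq_0_iff)
  then obtain b where b: "b - a \<in> maximal_ideal" "poly p b = 0"
    using hensel[OF over_A[OF p(1)] a p(3)] by blast
  \<comment> \<open>Division by \<open>p\<close> as an induction on the degree: cancelling the
    leading term with a multiple of \<open>p\<close> keeps the value at the root \<open>b\<close>,
    and below the degree of \<open>p\<close> minimality forces \<open>r = 0\<close>.\<close>
  have "poly r b = 0" if "r \<in> polys_over S" "poly r b \<in> maximal_ideal" for r
    using that
  proof (induction "degree r" arbitrary: r rule: less_induct)
    case less
    show ?case
    proof (cases "degree r < degree p")
      case True
      have "a - b \<in> maximal_ideal"
        using ideal_uminus[OF b(1)] by simp
      moreover have "b \<in> A"
        using add[OF a ideal_subset[OF b(1)]] by simp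
      ultimately have "poly r a - poly r b \<in> maximal_ideal"
        using poly_diff_mem_ideal[OF over_A[OF less.prems(1)]] by blast
      then have "poly r a \<in> maximal_ideal"
        using ideal_add[OF _ less.prems(2)] by fastforce
      then have "r = 0"
        using min[OF less.prems(1)] True by auto
      then show ?thesis
        by simp
    next
      case False
      define c where "c = lead_coeff r / lead_coeff p"
      define q where "q = r - monom c (degree r - degree p) * p"
      have c: "c \<in> S"
        unfolding c_def using less.prems(1) p(1) subfieldD(8)[OF S(1)] by (auto simp: polys_over_def)
      have q: "q \<in> polys_over S" "poly q b = poly r b"
        unfolding q_def using c p(1) less.prems(1) b(2) polys_over_subfield[OF S(1)] by auto
      have "r \<noteq> 0"
        using False deg by auto
      have "degree q < degree r"
      proof -
        have "coeff q (degree r) = 0"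
          using False p(2) coeff_monom_mult[of c "degree r - degree p" p "degree r"]
          by (auto simp: q_def c_def)
        moreover have "degree q \<le> degree r"
          unfolding q_def using False
          by (intro degree_diff_le) (auto intro!: order.trans[OF degree_mult_le]
              order.trans[OF add_right_mono[OF degree_monom_le]])
        ultimately show ?thesis
          using False deg eq_zero_or_degree_less[of q "degree r"] by auto
      qed
      then show ?thesis
        using less.hyps[of q] q less.prems by simp
    qed
  qed
  with b(1) show ?thesis
    by blast
qed

text \<open>The field \<open>T\<close> is \<open>S(b)\<close>, written as quotients of polynomial
  values. It stays inside \<open>A\<close> because \<open>b\<close> is chosen so that every nonzero
  denominator lies outside the ideal and is therefore invertible in \<open>A\<close>.\<close>

lemma subfield_extension:
  assumes S: "subfield S" "S \<subseteq> A" and a: "a \<in> A"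
  shows "\<exists>b T. subfield T \<and> S \<subseteq> T \<and> T \<subseteq> A \<and> b \<in> T \<and> b - a \<in> maximal_ideal"
proof -
  obtain b where b: "b - a \<in> maximal_ideal"
      and unit: "\<And>r. r \<in> polys_over S \<Longrightarrow> poly r b \<noteq> 0 \<Longrightarrow> poly r b \<notin> maximal_ideal"
    using congruent_element_poly_values[OF S a] by blast
  define T where "T = {poly q b / poly r b | q r. q \<in> polys_over S \<and> r \<in> polys_over S \<and> poly r b \<noteq> 0}"
  note ring = polys_over_subfield[OF S(1)]
  have T: "poly q b / poly r b \<in> T" if "q \<in> polys_over S" "r \<in> polys_over S" "poly r b \<noteq> 0" for q r
    using that by (auto simp: T_def)
  have T1: "poly q b \<in> T" if "q \<in> polys_over S" for q
    using T[OF that ring(1)[OF subfieldD(2)[OF S(1)]]] by simp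
  have const: "c \<in> T" if "c \<in> S" for c
    using T1[OF ring(1)[OF that]] by simp
  have "subfield T"
    unfolding subfield_def
  proof (intro conjI ballI)
    show "0 \<in> T" "1 \<in> T"
      using const subfieldD(1,2)[OF S(1)] by auto
  next
    fix x y assume "x \<in> T" "y \<in> T"
    then obtain p q r s where x: "x = poly p b / poly q b" "p \<in> polys_over S" "q \<in> polys_over S" "poly q b \<noteq> 0"
      and y: "y = poly r b / poly s b" "r \<in> polys_over S" "s \<in> polys_over S" "poly s b \<noteq> 0"
      by (auto simp: T_def)
    have "x + y = poly (p * s + r * q) b / poly (q * s) b" "x * y = poly (p * r) b / poly (q * s) b"
      using x(4) y(4) by (simp_all add: x(1) y(1) add_frac_eq)
    then show "x + y \<in> T" "x * y \<in> T"
      using T[of "p * s + r * q" "q * s"] T[of "p * r" "q * s"] x y ring by simp_all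
  next
    fix x assume "x \<in> T"
    then obtain p q where x: "x = poly p b / poly q b" "p \<in> polys_over S" "q \<in> polys_over S" "poly q b \<noteq> 0"
      by (auto simp: T_def)
    then show "- x \<in> T"
      using T[of "- p" q] ring by simp
    show "inverse x \<in> T"
      using x T[of q p] const[OF subfieldD(1)[OF S(1)]] by (cases "poly p b = 0") auto
  qed
  moreover have "S \<subseteq> T"
    using const by blast
  moreover have "T \<subseteq> A"
  proof
    fix x assume "x \<in> T"
    then obtain p q where x: "x = poly p b / poly q b" "p \<in> polys_over S" "q \<in> polys_over S" "poly q b \<noteq> 0"
      by (auto simp: T_def)
    have "b \<in> A"
      using add[OF a ideal_subset[OF b]] by simp
    then have "poly p b \<in> A"
      using poly_mem x(2) S(2) by (auto simp: polys_over_def)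
    then show "x \<in> A"
      unfolding x(1) divide_inverse using inverse_mem[OF unit[OF x(3,4)]] mult by blast
  qed
  moreover have "b \<in> T"
    using T1[of "[:0, 1:]"] subfieldD(1,2)[OF S(1)]
    by (auto simp: polys_over_def coeff_pCons split: nat.splits)
  ultimately show ?thesis
    using b by blast
qed

text \<open>Elements are adjoined one at a time; earlier lifts remain in the growing subfield, so
  all of them end in a common one.\<close>

lemma subfield_extension_finite:
  assumes S: "subfield S" "S \<subseteq> A" and I: "finite I" and a: "\<And>i. i \<in> I \<Longrightarrow> a i \<in> A"
  shows "\<exists>b T. subfield T \<and> S \<subseteq> T \<and> T \<subseteq> A \<and> (\<forall>i\<in>I. b i \<in> T \<and> b i - a i \<in> maximal_ideal)"
  using I a
proof (induction I)
  case empty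
  with S show ?case
    by auto
next
  case (insert j I)
  then obtain b T where T: "subfield T" "S \<subseteq> T" "T \<subseteq> A"
      and b: "\<forall>i\<in>I. b i \<in> T \<and> b i - a i \<in> maximal_ideal"
    by auto
  obtain c T' where T': "subfield T'" "T \<subseteq> T'" "T' \<subseteq> A" "c \<in> T'" "c - a j \<in> maximal_ideal"
    using subfield_extension[OF T(1,3)] insert.prems by blast
  have "\<forall>i\<in>insert j I. (b(j := c)) i \<in> T' \<and> (b(j := c)) i - a i \<in> maximal_ideal"
    using T' b insert.hyps(2) by auto
  with T T' show ?case
    by (meson order.trans)
qed

end

section \<open>The Lojasiewicz inequality\<close>

lemma linear_vec_eq_sum:
  fixes f :: "real^'n \<Rightarrow> real"
  assumes "bounded_linear f"
  shows "f x = (\<Sum>i\<in>UNIV. f (axis i 1) * x $ i)"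
proof -
  interpret f: bounded_linear f
    by fact
  have "f x = f (\<Sum>i\<in>UNIV. x $ i *\<^sub>R axis i 1)"
    using basis_expansion[of x] by (simp add: scalar_mult_eq_scaleR)
  also have "\<dots> = (\<Sum>i\<in>UNIV. f (axis i 1) * x $ i)"
    by (simp add: f.sum f.scaleR mult.commute)
  finally show ?thesis .
qed

lemma hyper_linear:
  fixes f :: "real^'n \<Rightarrow> real"
  assumes "bounded_linear f"
  shows "hyper (\<lambda>n. f (x n)) = (\<Sum>i\<in>UNIV. hyper (\<lambda>n. f (axis i 1)) * hyper (\<lambda>n. x n $ i))"
  by (subst linear_vec_eq_sum[OF assms]) (simp add: hyper_sum hyper_mult)

lemma hyper_polynomial_mem_subfield:
  fixes F :: "real^'n \<Rightarrow> real"
  assumes "real_polynomial_function F" and S: "subfield S" and const: "\<And>c. hyper (\<lambda>n. c) \<in> S"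
    and x: "\<And>i. hyper (\<lambda>n. x n $ i) \<in> S"
  shows "hyper (\<lambda>n. F (x n)) \<in> S"
  using assms(1)
proof induction
  case (linear f)
  then show ?case
    unfolding hyper_linear[OF linear, of x] by (intro subfield_sum[OF S] subfieldD(4)[OF S] const x)
qed (simp_all add: const hyper_add hyper_mult subfieldD(3,4)[OF S])

text \<open>Membership in \<open>A\<close> is proved together with the congruence because the
  product step, \<open>f y * g y - f x * g x = f y * (g y - g x) + g x * (f y - f x)\<close>, needs
  factors from \<open>A\<close>.\<close>

lemma hyper_polynomial_diff_mem_ideal:
  fixes F :: "real^'n \<Rightarrow> real"
  assumes "real_polynomial_function F" and "convex_subring A" and const: "\<And>c. hyper (\<lambda>n. c) \<in> A"
    and x: "\<And>i. hyper (\<lambda>n. x n $ i) \<in> A"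
    and y: "\<And>i. hyper (\<lambda>n. y n $ i) - hyper (\<lambda>n. x n $ i) \<in> convex_subring.maximal_ideal A"
  shows "hyper (\<lambda>n. F (x n)) \<in> A \<and>
    hyper (\<lambda>n. F (y n)) - hyper (\<lambda>n. F (x n)) \<in> convex_subring.maximal_ideal A"
proof -
  interpret A: convex_subring A
    by fact
  from assms(1) show ?thesis
  proof induction
    case (linear f)
    have "hyper (\<lambda>n. f (y n)) - hyper (\<lambda>n. f (x n)) =
        (\<Sum>i\<in>UNIV. hyper (\<lambda>n. f (axis i 1)) * (hyper (\<lambda>n. y n $ i) - hyper (\<lambda>n. x n $ i)))"
      unfolding hyper_linear[OF linear, of x] hyper_linear[OF linear, of y]
      by (simp add: sum_subtractf right_diff_distrib)
    also have "\<dots> \<in> A.maximal_ideal"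
      by (intro A.ideal_sum A.ideal_mult const y)
    finally show ?case
      unfolding hyper_linear[OF linear, of x] by (auto intro!: A.sum A.mult const x)
  next
    case (const c)
    then show ?case
      by (simp add: assms(3) A.ideal_zero)
  next
    case (add f g)
    then have "(hyper (\<lambda>n. f (y n)) - hyper (\<lambda>n. f (x n))) + (hyper (\<lambda>n. g (y n)) - hyper (\<lambda>n. g (x n)))
        \<in> A.maximal_ideal"
      using A.ideal_add by blast
    with add A.add show ?case
      by (simp add: hyper_add algebra_simps)
  next
    case (mult f g)
    define fx fy gx gy where "fx = hyper (\<lambda>n. f (x n))" and "fy = hyper (\<lambda>n. f (y n))"
      and "gx = hyper (\<lambda>n. g (x n))" and "gy = hyper (\<lambda>n. g (y n))"
    have IH: "fx \<in> A" "fy - fx \<in> A.maximal_ideal" "gx \<in> A" "gy - gx \<in> A.maximal_ideal"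
      using mult by (auto simp: fx_def fy_def gx_def gy_def)
    have "fy \<in> A"
      using A.add[OF IH(1) A.ideal_subset[OF IH(2)]] by simp
    then have "fy * (gy - gx) + gx * (fy - fx) \<in> A.maximal_ideal"
      using IH by (intro A.ideal_add A.ideal_mult)
    then have "fy * gy - fx * gx \<in> A.maximal_ideal"
      by (simp add: algebra_simps)
    moreover have "fx * gx \<in> A"
      using IH A.mult by blast
    ultimately show ?case
      by (simp add: hyper_mult fx_def fy_def gx_def gy_def)
  qed
qed

section \<open>Constants, and the ring defined by a positive null sequence\<close>

lemma subfield_range_hyper_const: "subfield (range (\<lambda>c. hyper (\<lambda>n. c)))"
  unfolding subfield_def
  by (auto simp: hyper_0[symmetric] hyper_1[symmetric] hyper_add[symmetric] hyper_mult[symmetric]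
      hyper_minus[symmetric] hyper_inverse[symmetric])

lemma hyper_le_sequentially: "eventually (\<lambda>n. x n \<le> y n) sequentially \<Longrightarrow> hyper x \<le> hyper y"
  unfolding hyper_le_iff by (rule filter_leD[OF ultra_le_sequentially])

text \<open>Quantifying over all exponents gives closure under products: the square of the bound for
  \<open>x * y\<close> at \<open>N\<close> is the product of the bounds for \<open>x\<close> and
  \<open>y\<close> at \<open>2 * N\<close>. Sums reduce to products through
  \<open>\<bar>x + y\<bar> \<le> 2 * max \<bar>x\<bar> \<bar>y\<bar>\<close>, and constants belong
  because \<open>e\<close> tends to zero.\<close>

lemma convex_subring_powers:
  assumes e: "e \<longlonglongrightarrow> 0" "\<And>n. 0 < e n"
  shows "convex_subring {a. \<forall>N. \<bar>a\<bar> ^ N * hyper e \<le> 1}" (is "convex_subring ?A")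
    and "hyper (\<lambda>n. c) \<in> {a. \<forall>N. \<bar>a\<bar> ^ N * hyper e \<le> 1}"
    and "hyper e \<in> convex_subring.maximal_ideal {a. \<forall>N. \<bar>a\<bar> ^ N * hyper e \<le> 1}"
proof -
  have e0: "0 < hyper e"
    unfolding hyper_0[symmetric] hyper_less_iff using e(2) by simp
  have const: "hyper (\<lambda>n. c) \<in> ?A" for c
  proof (intro CollectI allI)
    fix N
    have "(\<lambda>n. \<bar>c\<bar> ^ N * e n) \<longlonglongrightarrow> \<bar>c\<bar> ^ N * 0"
      using e(1) by (intro tendsto_intros)
    then have "eventually (\<lambda>n. \<bar>c\<bar> ^ N * e n < 1) sequentially"
      by (auto dest: order_tendstoD(2)[where a = 1])
    then have "hyper (\<lambda>n. \<bar>c\<bar> ^ N * e n) \<le> hyper (\<lambda>n. 1)"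
      by (intro hyper_le_sequentially) (auto elim: eventually_mono)
    then show "\<bar>hyper (\<lambda>n. c)\<bar> ^ N * hyper e \<le> 1"
      by (simp add: hyper_mult hyper_power hyper_abs hyper_1)
  qed
  have two: "2 \<in> ?A"
    using const[of "1 + 1"] unfolding hyper_add hyper_1 by simp
  have mult: "x * y \<in> ?A" if "x \<in> ?A" "y \<in> ?A" for x y
  proof (intro CollectI allI)
    fix N
    have "(\<bar>x * y\<bar> ^ N * hyper e)\<^sup>2 = (\<bar>x\<bar> ^ (2 * N) * hyper e) * (\<bar>y\<bar> ^ (2 * N) * hyper e)"
      by (simp add: abs_mult power_mult_distrib power_mult power2_eq_square mult_ac)
    also have "\<dots> \<le> 1"
    proof (rule mult_le_one)
      show "\<bar>x\<bar> ^ (2 * N) * hyper e \<le> 1" "\<bar>y\<bar> ^ (2 * N) * hyper e \<le> 1"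
        using that by blast+
      show "0 \<le> \<bar>y\<bar> ^ (2 * N) * hyper e"
        using e0 by simp
    qed
    finally show "\<bar>x * y\<bar> ^ N * hyper e \<le> 1"
      using power2_le_imp_le[of _ 1] by simp
  qed
  have convex: "x \<in> ?A" if "y \<in> ?A" "\<bar>x\<bar> \<le> \<bar>y\<bar>" for x y
  proof (intro CollectI allI)
    fix N
    have "\<bar>x\<bar> ^ N * hyper e \<le> \<bar>y\<bar> ^ N * hyper e"
      using that(2) e0 by (intro mult_right_mono power_mono) auto
    then show "\<bar>x\<bar> ^ N * hyper e \<le> 1"
      using that(1) order.trans by blast
  qed
  show ring: "convex_subring ?A"
  proof
    show "1 \<in> ?A"
      using const[of 1] by (simp add: hyper_1)
  next
    fix x y assume xy: "x \<in> ?A" "y \<in> ?A"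
    have "\<bar>x + y\<bar> \<le> \<bar>2 * x\<bar> \<or> \<bar>x + y\<bar> \<le> \<bar>2 * y\<bar>"
      by linarith
    then show "x + y \<in> ?A"
      using mult[OF two xy(1)] mult[OF two xy(2)] convex by blast
  qed (fact mult convex)+
  show "hyper (\<lambda>n. c) \<in> ?A"
    by (fact const)
  show "hyper e \<in> convex_subring.maximal_ideal ?A"
    unfolding convex_subring.maximal_ideal_def[OF ring]
  proof (intro CollectI ballI)
    fix a assume "a \<in> ?A"
    \<comment> \<open>The factor 2 sharpens the weak bound to the strict one that the ideal
      demands.\<close>
    then have "\<bar>2 * a\<bar> ^ 1 * hyper e \<le> 1"
      using mult[OF two] by blast
    then show "\<bar>a * hyper e\<bar> < 1"
      using e0 by (simp add: abs_mult)
  qed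
qed

theorem lojasiewicz_inequality:
  fixes F :: "real^'n \<Rightarrow> real"
  assumes F: "real_polynomial_function F" and K: "compact K"
  shows "\<exists>N c. N > 0 \<and> c > 0 \<and> (\<forall>x\<in>K. infdist x {z. F z = 0} ^ N \<le> c * \<bar>F x\<bar>)"
proof (cases "{z. F z = 0} = {}")
  case True
  \<comment> \<open>By convention \<open>infdist\<close> to the empty set is 0, so any positive
    constants work.\<close>
  show ?thesis
    unfolding True by (intro exI[of _ 1]) (simp add: infdist_def)
next
  case False
  define Z where "Z = {z. F z = 0}"
  obtain D where D: "D \<ge> 1" "\<And>x. x \<in> K \<Longrightarrow> infdist x Z \<le> D"
  proof -
    have "compact ((\<lambda>x. infdist x Z) ` K)"
      using K by (intro compact_continuous_image continuous_intros)
    then have "bdd_above ((\<lambda>x. infdist x Z) ` K)"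
      by (intro bounded_imp_bdd_above compact_imp_bounded)
    then obtain B where "\<And>x. x \<in> K \<Longrightarrow> infdist x Z \<le> B"
      by (auto simp: bdd_above_def)
    then show ?thesis
      by (intro that[of "max B 1"]) (auto simp: le_max_iff_disj)
  qed
  obtain B where B: "\<And>x. x \<in> K \<Longrightarrow> norm x \<le> B"
    using compact_imp_bounded[OF K] by (auto simp: bounded_iff)
  show ?thesis
  proof (rule ccontr)
    assume "\<not> ?thesis"
    \<comment> \<open>The failing exponent and constant grow together with \<open>k\<close>. The
      factor \<open>D ^ Suc k\<close> is absorbed by rescaling the distance to \<open>d\<close>,
      which is at most 1, so that its powers decrease with the exponent.\<close>
    then have "\<exists>x\<in>K. real (Suc k) * D ^ Suc k * \<bar>F x\<bar> < infdist x Z ^ Suc k" for k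
      using D(1) unfolding Z_def[symmetric]
      by (auto simp: not_le dest!: spec[of _ "Suc k"] spec[of _ "real (Suc k) * D ^ Suc k"])
    then obtain x where x: "\<And>k. x k \<in> K"
        "\<And>k. real (Suc k) * D ^ Suc k * \<bar>F (x k)\<bar> < infdist (x k) Z ^ Suc k"
      by metis
    define e where "e k = \<bar>F (x k)\<bar>" for k
    define d where "d k = infdist (x k) Z / D" for k
    have d: "0 \<le> d k" "d k \<le> 1" for k
      using D x(1)[of k] infdist_nonneg[of "x k" Z] by (auto simp: d_def)
    have de: "real (Suc k) * e k < d k ^ Suc k" for k
      using x(2)[of k] D(1) unfolding d_def e_def power_divide
      by (subst pos_less_divide_eq) (auto simp: mult_ac)
    have e: "0 < e k" for k
    proof (rule ccontr)
      assume "\<not> 0 < e k"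
      then have "x k \<in> Z"
        by (auto simp: e_def Z_def)
      then show False
        using de[of k] by (simp add: d_def e_def Z_def)
    qed
    have "e k < inverse (real (Suc k))" for k
    proof -
      have "real (Suc k) * e k < 1"
        using de[of k] power_le_one[of "d k" "Suc k"] d[of k] by linarith
      then show ?thesis
        by (simp add: field_simps)
    qed
    then have e_lim: "e \<longlonglongrightarrow> 0"
      using e by (intro tendsto_sandwich[OF _ _ tendsto_const LIMSEQ_inverse_real_of_nat])
        (auto intro!: always_eventually less_imp_le)
    define A where "A = {a. \<forall>N. \<bar>a\<bar> ^ N * hyper e \<le> 1}"
    note A = convex_subring_powers[OF e_lim e, folded A_def]
    interpret convex_subring_IVT A
      using A(1) hyperreal_poly_IVT
      by (auto simp: convex_subring_IVT_def convex_subring_IVT_axioms_def)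
    \<comment> \<open>Compactness of \<open>K\<close> bounds the coordinates by a constant, and
      \<open>A\<close> contains the constants.\<close>
    have xA: "hyper (\<lambda>n. x n $ i) \<in> A" for i
    proof (rule convex)
      show "hyper (\<lambda>n. B) \<in> A"
        by (fact A(2))
      have "\<bar>x n $ i\<bar> \<le> \<bar>B\<bar>" for n
        using component_le_norm_cart[of "x n" i] B[OF x(1)[of n]] by linarith
      then show "\<bar>hyper (\<lambda>n. x n $ i)\<bar> \<le> \<bar>hyper (\<lambda>n. B)\<bar>"
        by (simp add: hyper_abs[symmetric] hyper_le_iff)
    qed
    have "range (\<lambda>c. hyper (\<lambda>n. c)) \<subseteq> A"
      using A(2) by blast
    then have "\<exists>b T. subfield T \<and> range (\<lambda>c. hyper (\<lambda>n. c)) \<subseteq> T \<and> T \<subseteq> A \<and>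
        (\<forall>i\<in>UNIV. b i \<in> T \<and> b i - hyper (\<lambda>n. x n $ i) \<in> maximal_ideal)"
      by (rule subfield_extension_finite[OF subfield_range_hyper_const _ finite xA])
    then obtain b T where T: "subfield T" "range (\<lambda>c. hyper (\<lambda>n. c)) \<subseteq> T" "T \<subseteq> A"
      and bT: "\<forall>i\<in>UNIV. b i \<in> T \<and> b i - hyper (\<lambda>n. x n $ i) \<in> maximal_ideal"
      by (elim exE conjE)
    have b: "b i \<in> T" "b i - hyper (\<lambda>n. x n $ i) \<in> maximal_ideal" for i
      using bT by simp_all
    have "\<exists>y. \<forall>i. b i = hyper (y i)"
      by (intro choice allI) (meson hyper_cases)
    then obtain y' where y': "\<And>i. b i = hyper (y' i)"
      by blast
    \<comment> \<open>Representatives of the lifted coordinates are reassembled into a sequence of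
      real points, so that \<open>F\<close> can be evaluated on it.\<close>
    define y where "y n = (\<chi> i. y' i n)" for n
    have y: "b i = hyper (\<lambda>n. y n $ i)" for i
      by (simp add: y' y_def)
    have "hyper (\<lambda>n. F (y n)) \<in> T"
      using T(2) b(1) by (intro hyper_polynomial_mem_subfield[OF F T(1)]) (auto simp: y)
    moreover have "hyper (\<lambda>n. F (y n)) \<in> maximal_ideal"
    proof -
      have "\<bar>hyper (\<lambda>n. F (x n))\<bar> = hyper e"
        by (simp add: hyper_abs[symmetric] e_def[abs_def])
      then have "hyper (\<lambda>n. F (x n)) \<in> maximal_ideal"
        using ideal_convex[OF A(3)] by (metis abs_ge_self)
      then show ?thesis
        using hyper_polynomial_diff_mem_ideal[OF F A(1) A(2) xA, of y] b(2) ideal_add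
        by (fastforce simp: y)
    qed
    ultimately have "hyper (\<lambda>n. F (y n)) = 0"
      using subfield_ideal_eq_0[OF T(1,3)] by blast
    then have "eventually (\<lambda>n. y n \<in> Z) ultra"
      by (simp add: hyper_0[symmetric] hyper_eq_iff Z_def)
    \<comment> \<open>Almost every \<open>y n\<close> is a zero of \<open>F\<close>, so its distance
      to \<open>x n\<close> dominates \<open>d n\<close>. The l1 norm is used because it is a finite
      sum of coordinate differences, each in the ideal.\<close>
    then have "eventually (\<lambda>n. d n \<le> (\<Sum>i\<in>UNIV. \<bar>y n $ i - x n $ i\<bar>)) ultra"
    proof eventually_elim
      case (elim n)
      have "d n \<le> infdist (x n) Z"
        using D(1) infdist_nonneg[of "x n" Z] by (simp add: d_def divide_le_eq mult_le_cancel_left1)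
      also have "\<dots> \<le> norm (y n - x n)"
        using infdist_le[OF elim, of "x n"] by (simp add: dist_norm norm_minus_commute)
      also have "\<dots> \<le> (\<Sum>i\<in>UNIV. \<bar>y n $ i - x n $ i\<bar>)"
        using norm_le_l1_cart[of "y n - x n"] by simp
      finally show ?case .
    qed
    then have "hyper d \<le> (\<Sum>i\<in>UNIV. \<bar>b i - hyper (\<lambda>n. x n $ i)\<bar>)"
      by (simp add: hyper_le_iff[symmetric] hyper_sum hyper_abs hyper_diff y)
    moreover have "0 \<le> hyper d"
      using d(1) by (simp add: hyper_0[symmetric] hyper_le_iff)
    moreover have "\<bar>b i - hyper (\<lambda>n. x n $ i)\<bar> \<in> maximal_ideal" for i
      using ideal_convex[OF b(2)[of i]] by simp
    then have "(\<Sum>i\<in>UNIV. \<bar>b i - hyper (\<lambda>n. x n $ i)\<bar>) \<in> maximal_ideal"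
      by (rule ideal_sum)
    ultimately have d_ideal: "hyper d \<in> maximal_ideal"
      by (elim ideal_convex) linarith
    have d_pos: "0 < d n" for n
    proof -
      have "0 < real (Suc n) * e n"
        using e by simp
      then have "d n \<noteq> 0"
        using de[of n] by (auto simp del: of_nat_Suc)
      with d(1)[of n] show ?thesis
        by simp
    qed
    \<comment> \<open>For fixed \<open>N\<close>, every index \<open>n \<ge> N\<close> satisfies
      \<open>e n \<le> d n ^ Suc n \<le> d n ^ N\<close>. Thus \<open>hyper d\<close> has its
      inverse in \<open>A\<close>, which contradicts its membership in the ideal.\<close>
    have "inverse (hyper d) \<in> A"
      unfolding A_def
    proof (intro CollectI allI)
      fix N
      have "inverse (d n) ^ N * e n \<le> 1" if "n \<ge> N" for n
      proof -
        have "e n \<le> real (Suc n) * e n"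
          using e[of n] by simp
        also have "\<dots> \<le> d n ^ Suc n"
          using de[of n] by simp
        also have "\<dots> \<le> d n ^ N"
          using that d by (intro power_decreasing) auto
        finally show ?thesis
          using d_pos[of n] by (simp add: power_inverse field_simps)
      qed
      then have "hyper (\<lambda>n. inverse (d n) ^ N * e n) \<le> hyper (\<lambda>n. 1)"
        by (intro hyper_le_sequentially eventually_sequentiallyI)
      then show "\<bar>inverse (hyper d)\<bar> ^ N * hyper e \<le> 1"
        using \<open>0 \<le> hyper d\<close> by (simp add: hyper_mult hyper_power hyper_inverse hyper_1)
    qed
    then have "\<bar>inverse (hyper d) * hyper d\<bar> < 1"
      using d_ideal by (simp add: maximal_ideal_def)
    moreover have "0 < hyper d"
      using d_pos by (simp add: hyper_0[symmetric] hyper_less_iff)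
    ultimately show False
      by simp
  qed
qed

section \<open>Perturbed minimizers\<close>

lemma continuous_on_polynomial:
  "real_polynomial_function f \<Longrightarrow> continuous_on S f"
  using continuous_on_polymonial_function[of f S] by (simp add: real_polynomial_function_eq)

text \<open>Positivity of \<open>n\<close> matters at \<open>x = 0\<close>, since
  \<open>0 ^ 0 = 1\<close> whereas \<open>0 powr 0 = 0\<close>.\<close>

lemma power_powr:
  fixes x :: real
  assumes "0 \<le> x" "0 < n"
  shows "(x ^ n) powr a = x powr (real n * a)"
proof (cases "x = 0")
  case False
  then have "x ^ n = x powr real n"
    using assms(1) by (simp add: powr_realpow)
  then show ?thesis
    by (simp add: powr_powr)
qed (use assms(2) in simp)

theorem proposition6p2:
  fixes f :: "real^'n \<Rightarrow> real" and h :: "nat \<Rightarrow> real^'n \<Rightarrow> real" and m :: nat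
  assumes "real_polynomial_function f"
    and "\<And>i. i \<in> {1..m} \<Longrightarrow> real_polynomial_function (h i)"
    and "real_variety m h \<noteq> {}"
    and "compact (real_variety m h)"
  shows "\<exists>c \<tau> \<nu> :: real. c > 0 \<and> \<tau> > 0 \<and> \<nu> > 0 \<and>
    (\<forall>\<epsilon> :: real^'n. norm \<epsilon> \<le> \<nu> \<longrightarrow>
      global_minimizers (linear_perturbation f \<epsilon>) (real_variety m h)
        \<subseteq> global_minimizers f (real_variety m h)
          + (\<lambda>x. (c * norm \<epsilon> powr \<tau>) *\<^sub>R x) ` cball 0 1)"
proof -
  define V where "V = real_variety m h"
  define G where "G = global_minimizers f V"
  have V: "V \<noteq> {}" "compact V"
    using assms(3,4) by (auto simp: V_def)
  obtain x0 where x0: "x0 \<in> V" "\<And>x. x \<in> V \<Longrightarrow> f x0 \<le> f x"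
    using continuous_attains_inf[OF V(2,1) continuous_on_polynomial[OF assms(1)]] by blast
  have G_eq: "G = {x \<in> V. f x = f x0}"
    using x0 by (force simp: G_def global_minimizers_def is_arg_min_linorder)
  \<comment> \<open>The sum of squares merges the constraints and the equation
    \<open>f x = f x0\<close>, so its zero set is exactly \<open>G\<close>; on \<open>V\<close> only
    the square of \<open>f x - f x0\<close> survives.\<close>
  define F where "F x = (f x - f x0) ^ 2 + (\<Sum>i\<in>{1..m}. h i x ^ 2)" for x
  have "real_polynomial_function F"
    unfolding F_def using assms(1,2)
    by (intro real_polynomial_function.intros(2,3) real_polynomial_function_power
        real_polynomial_function_diff real_polynomial_function_sum) auto
  from lojasiewicz_inequality[OF this V(2)]
  obtain N c where N: "N > 0" "c > 0" "\<forall>x\<in>V. infdist x {z. F z = 0} ^ N \<le> c * \<bar>F x\<bar>"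
    by (elim exE conjE)
  have F_zero: "{z. F z = 0} = G"
    unfolding G_eq F_def V_def real_variety_def
    by (auto simp: add_nonneg_eq_0_iff sum_nonneg sum_nonneg_eq_0_iff)
  have F_V: "F x = (f x - f x0) ^ 2" if "x \<in> V" for x
    using that by (auto simp: F_def V_def real_variety_def)
  have "G \<noteq> {}" "closed G"
  proof -
    show "G \<noteq> {}"
      using x0(1) by (auto simp: G_eq)
    have "closed (V \<inter> f -` {f x0})"
      using continuous_on_polynomial[OF assms(1)] compact_imp_closed[OF V(2)]
      by (intro continuous_closed_preimage) auto
    then show "closed G"
      by (simp add: G_eq vimage_def Int_def)
  qed
  obtain D where D: "D > 0" "\<And>x y. x \<in> V \<Longrightarrow> y \<in> V \<Longrightarrow> dist x y \<le> D"
  proof -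
    obtain B where "\<And>x y. x \<in> V \<Longrightarrow> y \<in> V \<Longrightarrow> dist x y \<le> B"
      using compact_imp_bounded[OF V(2)] bounded_two_points[of V] by auto
    then show ?thesis
      by (intro that[of "max B 1"]) (auto simp: le_max_iff_disj)
  qed
  \<comment> \<open>Both constants come from taking the \<open>N\<close>-th root of
    \<open>infdist x G ^ N \<le> c * (norm \<epsilon> * D)\<^sup>2\<close>; the square in
    \<open>F\<close> puts the 2 into \<open>\<tau>\<close>.\<close>
  define C where "C = (c * D\<^sup>2) powr (1 / N)"
  define \<tau> where "\<tau> = 2 / real N"
  have "C > 0" "\<tau> > 0"
    using N D(1) by (simp_all add: C_def \<tau>_def)
  moreover have "global_minimizers (linear_perturbation f \<epsilon>) V
      \<subseteq> G + (\<lambda>x. (C * norm \<epsilon> powr \<tau>) *\<^sub>R x) ` cball 0 1" for \<epsilon>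
  proof
    fix x assume "x \<in> global_minimizers (linear_perturbation f \<epsilon>) V"
    then have x: "x \<in> V" "f x + \<epsilon> \<bullet> x \<le> f x0 + \<epsilon> \<bullet> x0"
      using x0(1) by (auto simp: global_minimizers_def is_arg_min_linorder linear_perturbation_def)
    have "f x - f x0 \<le> \<epsilon> \<bullet> (x0 - x)"
      using x(2) by (simp add: inner_diff_right)
    also have "\<dots> \<le> norm \<epsilon> * norm (x0 - x)"
      by (rule norm_cauchy_schwarz)
    also have "\<dots> \<le> norm \<epsilon> * D"
      using D(2)[OF x0(1) x(1)] by (intro mult_left_mono) (auto simp: dist_norm)
    finally have "(f x - f x0)\<^sup>2 \<le> (norm \<epsilon> * D)\<^sup>2"
      using x0(2)[OF x(1)] by (intro power_mono) auto
    then have "infdist x G ^ N \<le> c * (norm \<epsilon> * D)\<^sup>2"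
      using bspec[OF N(3) x(1)] N(2) F_V[OF x(1)] unfolding F_zero
      by (auto elim!: order.trans intro!: mult_left_mono)
    then have "(infdist x G ^ N) powr (1 / N) \<le> (c * (norm \<epsilon> * D)\<^sup>2) powr (1 / N)"
      by (intro powr_mono2) (auto simp: infdist_nonneg)
    also have "(infdist x G ^ N) powr (1 / N) = infdist x G"
      using N(1) by (simp add: power_powr infdist_nonneg)
    also have "(c * (norm \<epsilon> * D)\<^sup>2) powr (1 / N) = C * ((norm \<epsilon>)\<^sup>2) powr (1 / N)"
      using N(2) D(1) unfolding C_def by (subst powr_mult[symmetric]) (auto simp: power_mult_distrib mult_ac)
    also have "((norm \<epsilon>)\<^sup>2) powr (1 / N) = norm \<epsilon> powr \<tau>"
      by (simp add: power_powr \<tau>_def)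
    finally have le: "infdist x G \<le> C * norm \<epsilon> powr \<tau>" .
    obtain z where z: "z \<in> G" "infdist x G = dist x z"
      using infdist_attains_inf[OF \<open>closed G\<close> \<open>G \<noteq> {}\<close>] by blast
    define r where "r = C * norm \<epsilon> powr \<tau>"
    have "x - z \<in> (\<lambda>x. r *\<^sub>R x) ` cball 0 1"
    proof -
      have "norm (x - z) \<le> r"
        using le z(2) by (simp add: r_def dist_norm)
      \<comment> \<open>The ball is an image under scaling, so a preimage is found by dividing by
        \<open>r\<close>; for \<open>r = 0\<close>, as when \<open>\<epsilon> = 0\<close>, the image
        is just the origin and \<open>x = z\<close>.\<close>
      show ?thesis
      proof (cases "r = 0")
        case True
        with \<open>norm (x - z) \<le> r\<close> show ?thesis
          by (intro image_eqI[of _ _ 0]) auto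
      next
        case False
        then have "r > 0"
          using \<open>norm (x - z) \<le> r\<close> norm_ge_zero[of "x - z"] by linarith
        then show ?thesis
          using \<open>norm (x - z) \<le> r\<close>
          by (intro image_eqI[of _ _ "inverse r *\<^sub>R (x - z)"]) (auto simp: inverse_eq_divide divide_le_eq)
      qed
    qed
    then have "z + (x - z) \<in> G + (\<lambda>x. r *\<^sub>R x) ` cball 0 1"
      using z(1) by (intro set_plus_intro)
    then show "x \<in> G + (\<lambda>x. (C * norm \<epsilon> powr \<tau>) *\<^sub>R x) ` cball 0 1"
      by (simp add: r_def)
  qed
  ultimately show ?thesis
    unfolding G_def V_def by (intro exI[of _ C] exI[of _ \<tau>] exI[of _ 1]) auto
qed

end
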